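(* Let $T>0$, let $\alpha_1,\alpha_2\in(0,1)$ with $\alpha_1+\alpha_2>1$, and let $\eta_1\le\alpha_1$, $\eta_2\le\alpha_2$ be real numbers with $\eta_2>0$, $\eta_1+\eta_2>0$ and $\eta_1\neq 0$. Let $Y\in \mathcal{C}^{\alpha_1,\eta_1}((0,T])$ and $X\in\mathcal{C}^{\alpha_2,\eta_2}((0,T])$. Then for every $0<t\le T$ the limit $$\int_{0^+}^t Y_r\,dX_r:=\lim_{\varepsilon\to0^+}\int_\varepsilon^t Y_r\,dX_r$$ exists, where the integrals on the right are Young integrals. As a function of $t$, $\int_{0^+}^{\cdot}Y_r\,dX_r$ belongs to $\mathcal{C}^{\alpha_2,\eta}((0,T])$, where $\eta:=(\eta_1\wedge 0)+\eta_2>0$. Moreover there exists a constant $M>0$, depending only on $T,\alpha_1,\alpha_2,\eta_1,\eta_2$, such that for all such $X,Y$ $$\Big\|\int_{0^+}^{\cdot}Y_r\,dX_r\Big\|_{\alpha_2,\eta}\le M\big(|Y_T|+\|Y\|_{\alpha_1,\eta_1}\big)\|X\|_{\alpha_2,\eta_2}.$$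
   Context: For $0<\alpha<1$ and $\eta\le\alpha$, $\mathcal{C}^{\alpha,\eta}((0,T])$ is the set of continuous paths $Y:(0,T]\to\mathbb{R}$ with $$\|Y\|_{\alpha,\eta}:=\sup_{0<s<t\le T}\frac{|Y_t-Y_s|}{s^{\eta-\alpha}|t-s|^\alpha}<\infty .$$ Such a path is $\alpha$-Hölder on $[\varepsilon,T]$ for every $\varepsilon\in(0,T)$. For $0<s<t\le T$, $\int_s^tY_r\,dX_r$ denotes the Young integral on $[s,t]$ (limit of Riemann sums $\sum Y_{u}(X_v-X_u)$ over partitions of $[s,t]$ with mesh tending to zero), well defined since $\alpha_1+\alpha_2>1$. Notation: $a\wedge b=\min(a,b)$. *)

theory Defs
  imports "HOL-Analysis.Analysis"
begin

section \<open>Singular Hoelder spaces on a half-open interval\<close>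

text \<open>
  Paths on \<open>(0,T]\<close> are total functions of which only the values on \<open>{0<..T}\<close> matter.
\<close>

definition singular_holder_quotients ::
    "real \<Rightarrow> real \<Rightarrow> real \<Rightarrow> (real \<Rightarrow> real) \<Rightarrow> real set" where
  "singular_holder_quotients \<alpha> \<eta> T Y =
     {\<bar>Y t - Y s\<bar> / (s powr (\<eta> - \<alpha>) * \<bar>t - s\<bar> powr \<alpha>) |s t. 0 < s \<and> s < t \<and> t \<le> T}"

text \<open>
  The supremum is taken in \<open>real\<close>; it is the intended seminorm only if the set of quotients is
  bounded above, that is, for elements of \<open>singular_holder_space\<close> (and \<open>T > 0\<close>).
\<close>

definition singular_holder_norm :: "real \<Rightarrow> real \<Rightarrow> real \<Rightarrow> (real \<Rightarrow> real) \<Rightarrow> real" where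
  "singular_holder_norm \<alpha> \<eta> T Y = Sup (singular_holder_quotients \<alpha> \<eta> T Y)"

definition singular_holder_space :: "real \<Rightarrow> real \<Rightarrow> real \<Rightarrow> (real \<Rightarrow> real) set" where
  "singular_holder_space \<alpha> \<eta> T =
     {Y. continuous_on {0<..T} Y \<and> bdd_above (singular_holder_quotients \<alpha> \<eta> T Y)}"

section \<open>Young integrals\<close>

text \<open>The partition points are \<open>p 0 < \<dots> < p n\<close>; the values \<open>p i\<close> with \<open>i > n\<close> are irrelevant.\<close>

definition partition_points :: "real \<Rightarrow> real \<Rightarrow> nat \<Rightarrow> (nat \<Rightarrow> real) \<Rightarrow> bool" where
  "partition_points s t n p \<longleftrightarrow> p 0 = s \<and> p n = t \<and> (\<forall>i<n. p i < p (Suc i))"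

definition left_riemann_sum ::
    "(real \<Rightarrow> real) \<Rightarrow> (real \<Rightarrow> real) \<Rightarrow> nat \<Rightarrow> (nat \<Rightarrow> real) \<Rightarrow> real" where
  "left_riemann_sum Y X n p = (\<Sum>i<n. Y (p i) * (X (p (Suc i)) - X (p i)))"

definition has_young_integral ::
    "(real \<Rightarrow> real) \<Rightarrow> (real \<Rightarrow> real) \<Rightarrow> real \<Rightarrow> real \<Rightarrow> real \<Rightarrow> bool" where
  "has_young_integral Y X s t I \<longleftrightarrow>
     (\<forall>e>0. \<exists>d>0. \<forall>n p. partition_points s t n p \<and> (\<forall>i<n. p (Suc i) - p i < d)
        \<longrightarrow> \<bar>left_riemann_sum Y X n p - I\<bar> < e)"

definition young_integrable ::
    "(real \<Rightarrow> real) \<Rightarrow> (real \<Rightarrow> real) \<Rightarrow> real \<Rightarrow> real \<Rightarrow> bool" where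
  "young_integrable Y X s t \<longleftrightarrow> (\<exists>I. has_young_integral Y X s t I)"

definition young_integral ::
    "(real \<Rightarrow> real) \<Rightarrow> (real \<Rightarrow> real) \<Rightarrow> real \<Rightarrow> real \<Rightarrow> real" where
  "young_integral Y X s t = (THE I. has_young_integral Y X s t I)"

lemma has_young_integral_unique:
  assumes "s < t" and I: "has_young_integral Y X s t I" and J: "has_young_integral Y X s t J"
  shows "I = J"
proof (rule ccontr)
  assume "I \<noteq> J"
  define e where "e = \<bar>I - J\<bar> / 2"
  have "e > 0" using \<open>I \<noteq> J\<close> by (simp add: e_def)
  obtain d1 where d1: "d1 > 0" "\<And>n p. partition_points s t n p \<Longrightarrow> (\<forall>i<n. p (Suc i) - p i < d1)
        \<Longrightarrow> \<bar>left_riemann_sum Y X n p - I\<bar> < e"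
    using I \<open>e > 0\<close> unfolding has_young_integral_def by meson
  obtain d2 where d2: "d2 > 0" "\<And>n p. partition_points s t n p \<Longrightarrow> (\<forall>i<n. p (Suc i) - p i < d2)
        \<Longrightarrow> \<bar>left_riemann_sum Y X n p - J\<bar> < e"
    using J \<open>e > 0\<close> unfolding has_young_integral_def by meson
  define d where "d = min d1 d2"
  have "d > 0" using d1 d2 by (simp add: d_def)
  obtain n where n: "(t - s) / d < real n" using reals_Archimedean2 by blast
  have "0 < (t - s) / d" using \<open>d > 0\<close> \<open>s < t\<close> by simp
  with n have "0 < real n" by linarith
  define p where "p = (\<lambda>i. s + real i * ((t - s) / real n))"
  have step: "p (Suc i) - p i = (t - s) / real n" for i
    by (simp add: p_def algebra_simps add_divide_distrib diff_divide_distrib)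
  have small: "(t - s) / real n < d" using n \<open>d > 0\<close> \<open>0 < real n\<close> by (simp add: field_simps)
  have "0 < (t - s) / real n" using \<open>0 < real n\<close> \<open>s < t\<close> by simp
  then have "p i < p (Suc i)" for i using step[of i] by linarith
  then have part: "partition_points s t n p"
    using \<open>0 < real n\<close> by (simp add: partition_points_def p_def)
  have "\<bar>left_riemann_sum Y X n p - I\<bar> < e"
    by (rule d1(2)[OF part]) (use small step d_def in auto)
  moreover have "\<bar>left_riemann_sum Y X n p - J\<bar> < e"
    by (rule d2(2)[OF part]) (use small step d_def in auto)
  ultimately have "\<bar>I - J\<bar> < 2 * e" by arith
  then show False by (simp add: e_def)
qed

lemma young_integral_eq:
  assumes "s < t" and "has_young_integral Y X s t I"
  shows "young_integral Y X s t = I"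
  unfolding young_integral_def using assms has_young_integral_unique by blast

text \<open>
  The improper integral over \<open>(0,t]\<close>: existence includes that the Young integrals over all
  \<open>[\<epsilon>,t]\<close> exist, so that the limit is never one of unspecified values of \<open>young_integral\<close>.
\<close>

definition has_improper_young_integral ::
    "(real \<Rightarrow> real) \<Rightarrow> (real \<Rightarrow> real) \<Rightarrow> real \<Rightarrow> real \<Rightarrow> bool" where
  "has_improper_young_integral Y X t I \<longleftrightarrow>
     (\<forall>\<epsilon>\<in>{0<..<t}. young_integrable Y X \<epsilon> t) \<and>
     ((\<lambda>\<epsilon>. young_integral Y X \<epsilon> t) \<longlongrightarrow> I) (at_right 0)"

definition improper_young_integral ::
    "(real \<Rightarrow> real) \<Rightarrow> (real \<Rightarrow> real) \<Rightarrow> real \<Rightarrow> real" where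
  "improper_young_integral Y X t = Lim (at_right 0) (\<lambda>\<epsilon>. young_integral Y X \<epsilon> t)"

end

theory Submission
  imports Defs
begin

text \<open>
  The germ \<open>\<mu> u v = Y u * (X v - X u)\<close> is almost additive: for \<open>0 < a \<le> b \<le> c \<le> T\<close> the error
  \<open>\<mu> a c - \<mu> a b - \<mu> b c = - (Y b - Y a) * (X c - X b)\<close> is at most a constant times
  \<open>a powr (\<eta>1 + \<eta>2 - \<theta>) * (c - a) powr \<theta>\<close>, where \<open>\<theta> = \<alpha>1 + \<alpha>2 > 1\<close>. A sewing lemma, \<open>sewing\<close>,
  produces one function \<open>F\<close> on all of \<open>(0,T]\<close> whose increments agree with \<open>\<mu>\<close> up to an error of this
  form. Since \<open>\<theta> > 1\<close>, these errors vanish when summed over a fine partition, so the Young integral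
  over \<open>[s,t]\<close> is \<open>F t - F s\<close> (\<open>has_young_integral_of_primitive\<close>). The theorem is thereby reduced to
  estimates on \<open>F\<close>: the improper integral exists if \<open>F\<close> has a limit at \<open>0\<close>, and then it has the same
  increments as \<open>F\<close>.

  The estimates compare scales \<open>s, 2s, 4s, \<dots>\<close> and sum a geometric series
  (\<open>dyadic_chaining\<close>). Applied to \<open>Y\<close>, whose increments over \<open>[s, 2s]\<close> are of order \<open>s powr \<eta>1\<close>, this
  shows that \<open>\<bar>Y s\<bar>\<close> is of order \<open>s powr min \<eta>1 0\<close> (\<open>singular_holder_growth\<close>); for \<open>\<eta>1 = 0\<close> the
  chain would produce a logarithm instead. With the local error of \<open>F\<close> this gives the desired Hoelder
  bound on \<open>F t - F s\<close> for intervals with \<open>t \<le> 2 s\<close>, where \<open>(t - s) powr \<theta>\<close> is at most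
  \<open>s powr \<alpha>1 * (t - s) powr \<alpha>2\<close>. Applied to \<open>F\<close>, with exponent \<open>\<eta> = min \<eta>1 0 + \<eta>2 > 0\<close>, chaining
  extends the bound to all intervals and shows that the oscillation of \<open>F\<close> on \<open>(0,t]\<close> is of order
  \<open>t powr \<eta>\<close>, whence the limit at \<open>0\<close> (\<open>singular_holder_chaining\<close>, \<open>limit_at_zero\<close>).
\<close>

section \<open>Sewing of almost additive germs\<close>

text \<open>
  For \<open>\<theta> > 1\<close>, the solution of \<open>C = 2 * (C * (1/2) powr \<theta>) + 2\<close>, the recursion that arises when an interval is
  cut into two parts of at most half its length and one partition interval between them.
\<close>

definition sewing_constant :: "real \<Rightarrow> real" where
  "sewing_constant \<theta> = 2 / (1 - 2 powr (1 - \<theta>))"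

lemma sewing_constant_pos: "\<theta> > 1 \<Longrightarrow> sewing_constant \<theta> > 0"
proof -
  assume "\<theta> > 1"
  then have "2 powr (1 - \<theta>) < (2::real) powr 0" by (intro powr_less_mono) auto
  then show ?thesis by (simp add: sewing_constant_def)
qed

lemma sewing_constant_halving:
  assumes "\<theta> > 1"
  shows "2 * (sewing_constant \<theta> * (1/2) powr \<theta>) + 2 = sewing_constant \<theta>"
proof -
  define q where "q = (2::real) powr (1 - \<theta>)"
  have "(2::real) powr (1 - \<theta>) < 2 powr 0" using assms by (intro powr_less_mono) auto
  then have "q < 1" by (simp add: q_def)
  have "(1/2) powr \<theta> = q / 2" by (simp add: q_def powr_diff powr_divide)
  then have "2 * (2 / (1 - q) * (1/2) powr \<theta>) + 2 = 2 / (1 - q)"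
    using \<open>q < 1\<close> by (simp add: field_simps)
  then show ?thesis by (simp add: sewing_constant_def q_def)
qed

text \<open>
  The interval from \<open>p i\<close> to \<open>p j\<close>, of length \<open>L\<close>, is cut at the last partition point \<open>p k\<close> of its left half
  and at the next point \<open>p (Suc k)\<close>. Both outer parts have length at most \<open>L / 2\<close>, the middle part is a
  single partition interval, and replacing \<open>\<mu> (p i) (p j)\<close> by the sum over the three parts costs at
  most \<open>2 * H * L powr \<theta>\<close>. The constant is independent of the number of partition points because
  \<open>2 * (1/2) powr \<theta> < 1\<close>.
\<close>

lemma germ_sum_estimate:
  fixes p :: "nat \<Rightarrow> real" and \<mu> :: "real \<Rightarrow> real \<Rightarrow> real"
  assumes \<theta>: "\<theta> > 1" and H: "H \<ge> 0"
  shows "\<lbrakk>i \<le> j; strict_mono_on {i..j} p;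
      \<And>a b c. \<lbrakk>a \<in> p ` {i..j}; b \<in> p ` {i..j}; c \<in> p ` {i..j}; a \<le> b; b \<le> c\<rbrakk>
        \<Longrightarrow> \<bar>\<mu> a c - \<mu> a b - \<mu> b c\<bar> \<le> H * (c - a) powr \<theta>\<rbrakk>
    \<Longrightarrow> \<bar>(\<Sum>k\<in>{i..<j}. \<mu> (p k) (p (Suc k))) - \<mu> (p i) (p j)\<bar>
        \<le> sewing_constant \<theta> * (H * (p j - p i) powr \<theta>)"
proof (induction "j - i" arbitrary: i j rule: less_induct)
  case less
  note mono = less.prems(2) and defect = less.prems(3)
  let ?C = "sewing_constant \<theta>" and ?S = "\<lambda>i j. \<Sum>k\<in>{i..<j}. \<mu> (p k) (p (Suc k))"
  have C: "?C > 0" using sewing_constant_pos[OF \<theta>] .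
  show ?case
  proof (cases "i = j")
    case True
    then show ?thesis using defect[of "p i" "p i" "p i"] by simp
  next
    case False
    with less.prems(1) have "i < j" by simp
    define L where "L = p j - p i"
    have "L > 0" using strict_mono_onD[OF mono] \<open>i < j\<close> by (simp add: L_def)
    define k where "k = Max {k\<in>{i..j}. p k - p i \<le> L / 2}"
    have fin: "finite {k\<in>{i..j}. p k - p i \<le> L / 2}" by simp
    have "i \<in> {k\<in>{i..j}. p k - p i \<le> L / 2}" using \<open>L > 0\<close> \<open>i < j\<close> by simp
    then have k: "k \<in> {k\<in>{i..j}. p k - p i \<le> L / 2}"
      unfolding k_def using Max_in[OF fin] by blast
    have "k \<noteq> j" using k \<open>L > 0\<close> by (auto simp: L_def)
    then have kj: "i \<le> k" "k < j" using k by auto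
    have "Suc k \<notin> {k\<in>{i..j}. p k - p i \<le> L / 2}"
      using Max_ge[OF fin, of "Suc k"] unfolding k_def[symmetric] by auto
    then have right: "p j - p (Suc k) \<le> L / 2" using kj by (auto simp: L_def field_simps)
    have left: "p k - p i \<le> L / 2" using k by simp
    have le: "p a \<le> p b" if "i \<le> a" "a \<le> b" "b \<le> j" for a b
      using strict_mono_on_leD[OF mono, of a b] that by simp
    have half: "H * x powr \<theta> \<le> (1/2) powr \<theta> * (H * L powr \<theta>)" if "0 \<le> x" "x \<le> L / 2" for x
    proof -
      have "x powr \<theta> \<le> (1/2 * L) powr \<theta>" using that \<theta> by (intro powr_mono2) auto
      also have "\<dots> = (1/2) powr \<theta> * L powr \<theta>" using \<open>L > 0\<close> by (intro powr_mult) 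
      finally have "H * x powr \<theta> \<le> H * ((1/2) powr \<theta> * L powr \<theta>)" using H by (rule mult_left_mono)
      then show ?thesis by (simp add: mult_ac)
    qed
    have "\<bar>?S i k - \<mu> (p i) (p k)\<bar> \<le> ?C * (H * (p k - p i) powr \<theta>)"
    proof (rule less.hyps)
      show "strict_mono_on {i..k} p" using mono kj by (auto simp: strict_mono_on_def)
      show "\<bar>\<mu> a c - \<mu> a b - \<mu> b c\<bar> \<le> H * (c - a) powr \<theta>"
        if "a \<in> p ` {i..k}" "b \<in> p ` {i..k}" "c \<in> p ` {i..k}" "a \<le> b" "b \<le> c" for a b c
        using that kj by (intro defect) auto
    qed (use kj in auto)
    also have "\<dots> \<le> ?C * ((1/2) powr \<theta> * (H * L powr \<theta>))"
      using C kj left le[of i k] by (intro mult_left_mono half) auto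
    finally have 1: "\<bar>?S i k - \<mu> (p i) (p k)\<bar> \<le> ?C * ((1/2) powr \<theta> * (H * L powr \<theta>))" .
    have "\<bar>?S (Suc k) j - \<mu> (p (Suc k)) (p j)\<bar> \<le> ?C * (H * (p j - p (Suc k)) powr \<theta>)"
    proof (rule less.hyps)
      show "strict_mono_on {Suc k..j} p" using mono kj by (auto simp: strict_mono_on_def)
      show "\<bar>\<mu> a c - \<mu> a b - \<mu> b c\<bar> \<le> H * (c - a) powr \<theta>"
        if "a \<in> p ` {Suc k..j}" "b \<in> p ` {Suc k..j}" "c \<in> p ` {Suc k..j}" "a \<le> b" "b \<le> c" for a b c
        using that kj by (intro defect) auto
    qed (use kj in auto)
    also have "\<dots> \<le> ?C * ((1/2) powr \<theta> * (H * L powr \<theta>))"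
      using C kj right le[of "Suc k" j] by (intro mult_left_mono half) auto
    finally have 2: "\<bar>?S (Suc k) j - \<mu> (p (Suc k)) (p j)\<bar> \<le> ?C * ((1/2) powr \<theta> * (H * L powr \<theta>))" .
    have 3: "\<bar>\<mu> (p i) (p j) - \<mu> (p i) (p k) - \<mu> (p k) (p j)\<bar> \<le> H * L powr \<theta>"
      unfolding L_def using kj le by (intro defect) auto
    have "\<bar>\<mu> (p k) (p j) - \<mu> (p k) (p (Suc k)) - \<mu> (p (Suc k)) (p j)\<bar> \<le> H * (p j - p k) powr \<theta>"
      using kj le by (intro defect) auto
    also have "\<dots> \<le> H * L powr \<theta>"
      unfolding L_def using kj le[of i k] le[of k j] H \<theta> by (intro mult_left_mono powr_mono2) auto
    finally have 4: "\<bar>\<mu> (p k) (p j) - \<mu> (p k) (p (Suc k)) - \<mu> (p (Suc k)) (p j)\<bar> \<le> H * L powr \<theta>" .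
    have "?S i j = ?S i k + ?S k j"
      using kj by (simp add: sum.atLeastLessThan_concat)
    also have "?S k j = \<mu> (p k) (p (Suc k)) + ?S (Suc k) j"
      using kj by (simp add: sum.atLeast_Suc_lessThan)
    finally have "\<bar>?S i j - \<mu> (p i) (p j)\<bar> \<le> 2 * (?C * ((1/2) powr \<theta> * (H * L powr \<theta>))) + 2 * (H * L powr \<theta>)"
      using 1 2 3 4 by arith
    also have "\<dots> = (2 * (?C * (1/2) powr \<theta>) + 2) * (H * L powr \<theta>)"
      by (simp add: algebra_simps)
    also have "\<dots> = ?C * (H * L powr \<theta>)" by (simp only: sewing_constant_halving[OF \<theta>])
    finally show ?thesis by (simp add: L_def)
  qed
qed

text \<open>
  The set of functions satisfying the conclusion for a given pair \<open>u, v\<close> is closed in the product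
  topology. For finitely many pairs, a common solution is given by the partial sums of \<open>\<mu>\<close> along
  the finite set of points that occur, by \<open>germ_sum_estimate\<close>. Normalising by \<open>F T = 0\<close> confines all
  values \<open>F x\<close> to compact intervals, so that by Tychonoff's theorem the finite intersection property
  provides a solution for all pairs at once. The weight \<open>w\<close> may be unbounded on \<open>S\<close>, so that a
  single \<open>F\<close> serves all of \<open>(0,T]\<close> in the presence of a singularity at \<open>0\<close>.
\<close>

theorem sewing:
  fixes \<mu> :: "real \<Rightarrow> real \<Rightarrow> real" and w :: "real \<Rightarrow> real"
  assumes \<theta>: "\<theta> > 1" and T: "T \<in> S" "\<And>x. x \<in> S \<Longrightarrow> x \<le> T"
    and w: "\<And>x. x \<in> S \<Longrightarrow> w x \<ge> 0" "\<And>x y. \<lbrakk>x \<in> S; y \<in> S; x \<le> y\<rbrakk> \<Longrightarrow> w y \<le> w x"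
    and defect: "\<And>a b c. \<lbrakk>a \<in> S; b \<in> S; c \<in> S; a \<le> b; b \<le> c\<rbrakk>
        \<Longrightarrow> \<bar>\<mu> a c - \<mu> a b - \<mu> b c\<bar> \<le> w a * (c - a) powr \<theta>"
  obtains F where "\<And>u v. \<lbrakk>u \<in> S; v \<in> S; u < v\<rbrakk>
        \<Longrightarrow> \<bar>F v - F u - \<mu> u v\<bar> \<le> sewing_constant \<theta> * (w u * (v - u) powr \<theta>)"
proof -
  define \<omega> where "\<omega> u v = sewing_constant \<theta> * (w u * (v - u) powr \<theta>)" for u v
  define P where "P = {e \<in> S \<times> S. fst e < snd e}"
  define sewn where "sewn e = {F :: real \<Rightarrow> real. \<bar>F (snd e) - F (fst e) - \<mu> (fst e) (snd e)\<bar> \<le> \<omega> (fst e) (snd e)}" for e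
  define B where "B x = (if x \<in> S then cball (- \<mu> x T) (\<omega> x T) else {0})" for x
  have "compact (PiE UNIV B)"
  proof -
    have "compactin (product_topology (\<lambda>i. euclidean) UNIV) (PiE UNIV B)"
      unfolding compactin_PiE by (auto simp: B_def)
    then show ?thesis by (simp add: euclidean_product_topology)
  qed
  then have "PiE UNIV B \<inter> (\<Inter>e\<in>P. sewn e) \<noteq> {}"
  proof (rule compact_imp_fip_image)
    show "closed (sewn e)" for e
      unfolding sewn_def by (intro closed_Collect_le continuous_intros continuous_on_product_coordinates)
    fix I assume I: "finite I" "I \<subseteq> P"
    define A where "A = insert T (fst ` I \<union> snd ` I)"
    have A: "finite A" "A \<subseteq> S" "T \<in> A" using I T by (auto simp: A_def P_def)
    define p where "p k = sorted_list_of_set A ! k" for k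
    define m where "m = card A - 1"
    have card: "card A = Suc m" using A card_gt_0_iff[of A] by (auto simp: m_def)
    have mono: "strict_mono_on {..m} p"
      unfolding p_def
      using strict_sorted_list_of_set[of A] card A(1)
      by (auto simp: strict_mono_on_def sorted_wrt_iff_nth_less)
    have imp: "p ` {..m} = A"
    proof -
      have "A = set (sorted_list_of_set A)" using A by simp
      also have "\<dots> = p ` {..m}"
        unfolding set_conv_nth p_def using card A(1) by (auto simp: less_Suc_eq_le)
      finally show ?thesis by simp
    qed
    define idx where "idx = inv_into {..m} p"
    have idx: "idx x \<le> m" "p (idx x) = x" if "x \<in> A" for x
      using inv_into_into[of x p "{..m}"] f_inv_into_f[of x p "{..m}"] that imp by (auto simp: idx_def)
    have idx_less: "idx u < idx v" if "u \<in> A" "v \<in> A" "u < v" for u v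
      using strict_mono_on_leD[OF mono, of "idx v" "idx u"] idx that by force
    (* Points of S outside A are subject only to the compactness constraint, at whose centre they are put. *)
    define F where "F x = (if x \<in> S then if x \<in> A
        then - (\<Sum>k\<in>{idx x..<idx T}. \<mu> (p k) (p (Suc k))) else - \<mu> x T else 0)" for x
    have est: "\<bar>(\<Sum>k\<in>{idx u..<idx v}. \<mu> (p k) (p (Suc k))) - \<mu> u v\<bar> \<le> \<omega> u v"
      if uv: "u \<in> A" "v \<in> A" "u \<le> v" for u v
    proof -
      have "\<bar>(\<Sum>k\<in>{idx u..<idx v}. \<mu> (p k) (p (Suc k))) - \<mu> (p (idx u)) (p (idx v))\<bar>
          \<le> sewing_constant \<theta> * (w u * (p (idx v) - p (idx u)) powr \<theta>)"
      proof (rule germ_sum_estimate[OF \<theta>])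
        show "0 \<le> w u" using w uv A by auto
        show "idx u \<le> idx v" using idx_less[of u v] uv by (cases "u = v") auto
        show "strict_mono_on {idx u..idx v} p"
          using mono idx uv by (auto simp: strict_mono_on_def) (meson le_trans less_imp_le)
        fix a b c assume abc: "a \<in> p ` {idx u..idx v}" "b \<in> p ` {idx u..idx v}"
            "c \<in> p ` {idx u..idx v}" "a \<le> b" "b \<le> c"
        have sub: "p ` {idx u..idx v} \<subseteq> A" using imp idx(1)[OF uv(2)] by force
        have "u \<le> a"
        proof -
          obtain k where "a = p k" "idx u \<le> k" "k \<le> idx v" using abc by auto
          then show ?thesis using strict_mono_on_leD[OF mono, of "idx u" k] idx uv
            by (metis atMost_iff le_trans)
        qed
        then have "w a \<le> w u" using w(2) sub abc uv A by blast
        have "\<bar>\<mu> a c - \<mu> a b - \<mu> b c\<bar> \<le> w a * (c - a) powr \<theta>" using defect sub abc A by blast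
        also have "\<dots> \<le> w u * (c - a) powr \<theta>" using \<open>w a \<le> w u\<close> by (simp add: mult_right_mono)
        finally show "\<bar>\<mu> a c - \<mu> a b - \<mu> b c\<bar> \<le> w u * (c - a) powr \<theta>" .
      qed
      then show ?thesis using idx uv by (simp add: \<omega>_def)
    qed
    have "F x \<in> B x" for x
    proof -
      have "\<omega> x T \<ge> 0" if "x \<in> S"
        using w that sewing_constant_pos[OF \<theta>] by (simp add: \<omega>_def)
      then show ?thesis using est[of x T] A(3) T
        by (auto simp: F_def B_def dist_real_def abs_minus_commute)
    qed
    moreover have "F \<in> sewn e" if "e \<in> I" for e
    proof -
      obtain u v where e: "e = (u, v)" by force
      have uv: "u \<in> A" "v \<in> A" "u < v" using that I e by (force simp: A_def P_def)+
      have "idx u \<le> idx v" "idx v \<le> idx T"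
        using idx_less[of u v] idx_less[of v T] uv A T by (auto simp: order.order_iff_strict)
      then have "(\<Sum>k\<in>{idx u..<idx T}. \<mu> (p k) (p (Suc k)))
          = (\<Sum>k\<in>{idx u..<idx v}. \<mu> (p k) (p (Suc k))) + (\<Sum>k\<in>{idx v..<idx T}. \<mu> (p k) (p (Suc k)))"
        by (simp add: sum.atLeastLessThan_concat)
      moreover have "u \<in> S" "v \<in> S" using uv A by auto
      ultimately show ?thesis using est[of u v] uv by (simp add: sewn_def e F_def)
    qed
    ultimately show "PiE UNIV B \<inter> (\<Inter>e\<in>I. sewn e) \<noteq> {}" by blast
  qed
  then obtain F where "F \<in> (\<Inter>e\<in>P. sewn e)" by blast
  then have "\<bar>F v - F u - \<mu> u v\<bar> \<le> \<omega> u v" if "u \<in> S" "v \<in> S" "u < v" for u v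
    using that by (force simp: P_def sewn_def)
  then show thesis unfolding \<omega>_def by (rule that)
qed

section \<open>Chaining over dyadic scales\<close>

text \<open>
  The sum of the geometric series with ratio \<open>2 powr - \<bar>\<gamma>\<bar>\<close>, for \<open>\<gamma> \<noteq> 0\<close>.
\<close>

definition dyadic_constant :: "real \<Rightarrow> real" where
  "dyadic_constant \<gamma> = 1 / (1 - 2 powr (- \<bar>\<gamma>\<bar>))"

lemma dyadic_constant:
  assumes "\<gamma> \<noteq> 0"
  shows "dyadic_constant \<gamma> \<ge> 1" "1 + dyadic_constant \<gamma> * 2 powr (- \<bar>\<gamma>\<bar>) = dyadic_constant \<gamma>"
proof -
  define q where "q = (2::real) powr (- \<bar>\<gamma>\<bar>)"
  have "(2::real) powr (- \<bar>\<gamma>\<bar>) < 2 powr 0" using assms by (intro powr_less_mono) auto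
  then have q: "0 < q" "q < 1" by (simp_all add: q_def)
  then have "1 / (1 - q) \<ge> 1" "1 + 1 / (1 - q) * q = 1 / (1 - q)" by (simp_all add: field_simps)
  then show "dyadic_constant \<gamma> \<ge> 1" "1 + dyadic_constant \<gamma> * 2 powr (- \<bar>\<gamma>\<bar>) = dyadic_constant \<gamma>"
    by (simp_all add: dyadic_constant_def q_def)
qed

text \<open>
  The increments over dyadic intervals form a geometric series, dominated by the largest interval
  if \<open>\<gamma> > 0\<close> and by the one closest to \<open>0\<close> if \<open>\<gamma> < 0\<close>. Accordingly, the induction on the
  number of dyadic scales splits off \<open>[t/2, t]\<close> in the first case and \<open>[s, 2s]\<close> in the second.
\<close>

lemma dyadic_chaining:
  fixes G :: "real \<Rightarrow> real"
  assumes \<gamma>: "\<gamma> \<noteq> 0" and A: "A \<ge> 0"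
    and step: "\<And>s t. \<lbrakk>0 < s; s < t; t \<le> T; t \<le> 2 * s\<rbrakk> \<Longrightarrow> \<bar>G t - G s\<bar> \<le> A * s powr \<gamma>"
    and st: "0 < s" "s < t" "t \<le> T"
  shows "\<bar>G t - G s\<bar> \<le> A * dyadic_constant \<gamma> * max (s powr \<gamma>) (t powr \<gamma>)"
proof -
  let ?K = "dyadic_constant \<gamma>"
  note K = dyadic_constant[OF \<gamma>]
  have "t \<le> 2 ^ n * s \<Longrightarrow> ?thesis" for n
    using st
  proof (induction n arbitrary: s t)
    case 0
    then show ?case by simp
  next
    case (Suc n)
    show ?case
    proof (cases "t \<le> 2 * s")
      case True
      have "\<bar>G t - G s\<bar> \<le> A * s powr \<gamma>" using step Suc.prems True by simp
      also have "\<dots> \<le> (A * ?K) * max (s powr \<gamma>) (t powr \<gamma>)"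
        using K A mult_left_mono[OF K(1) A] by (intro mult_mono) auto
      finally show ?thesis .
    next
      case False
      consider "\<gamma> > 0" | "\<gamma> < 0" using \<gamma> by linarith
      then show ?thesis
      proof cases
        case 1
        have half: "(t / 2) powr \<gamma> = 2 powr (- \<bar>\<gamma>\<bar>) * t powr \<gamma>"
          using 1 by (simp add: powr_divide powr_minus field_simps)
        have "\<bar>G (t / 2) - G s\<bar> \<le> A * ?K * max (s powr \<gamma>) ((t / 2) powr \<gamma>)"
          using Suc.prems False by (intro Suc.IH) auto
        also have "max (s powr \<gamma>) ((t / 2) powr \<gamma>) = (t / 2) powr \<gamma>"
          using Suc.prems False 1 powr_mono2[of \<gamma> s "t / 2"] by simp
        finally have "\<bar>G (t / 2) - G s\<bar> \<le> A * ?K * (t / 2) powr \<gamma>" .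
        moreover have "\<bar>G t - G (t / 2)\<bar> \<le> A * (t / 2) powr \<gamma>" using Suc.prems by (intro step) auto
        moreover have "A * (t / 2) powr \<gamma> \<le> A * t powr \<gamma>"
          using A Suc.prems 1 by (intro mult_left_mono powr_mono2) auto
        ultimately have "\<bar>G t - G s\<bar> \<le> A * (1 + ?K * 2 powr (- \<bar>\<gamma>\<bar>)) * t powr \<gamma>"
          by (simp add: half algebra_simps)
        also have "\<dots> = A * ?K * t powr \<gamma>" by (simp only: K)
        also have "\<dots> \<le> A * ?K * max (s powr \<gamma>) (t powr \<gamma>)"
          using A K by (intro mult_left_mono) auto
        finally show ?thesis .
      next
        case 2
        have dbl: "(2 * s) powr \<gamma> = 2 powr (- \<bar>\<gamma>\<bar>) * s powr \<gamma>"
          using 2 Suc.prems by (simp add: powr_mult)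
        have "\<bar>G t - G (2 * s)\<bar> \<le> A * ?K * max ((2 * s) powr \<gamma>) (t powr \<gamma>)"
          using Suc.prems False by (intro Suc.IH) auto
        also have "max ((2 * s) powr \<gamma>) (t powr \<gamma>) = (2 * s) powr \<gamma>"
          using Suc.prems False 2 powr_mono2'[of \<gamma> "2 * s" t] by simp
        finally have "\<bar>G t - G (2 * s)\<bar> \<le> A * ?K * (2 * s) powr \<gamma>" .
        moreover have "\<bar>G (2 * s) - G s\<bar> \<le> A * s powr \<gamma>" using Suc.prems False by (intro step) auto
        ultimately have "\<bar>G t - G s\<bar> \<le> A * (1 + ?K * 2 powr (- \<bar>\<gamma>\<bar>)) * s powr \<gamma>"
          unfolding dbl by (simp add: algebra_simps)
        also have "\<dots> = A * ?K * s powr \<gamma>" by (simp only: K)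
        also have "\<dots> \<le> A * ?K * max (s powr \<gamma>) (t powr \<gamma>)"
          using A K by (intro mult_left_mono) auto
        finally show ?thesis .
      qed
    qed
  qed
  moreover obtain n where "t / s < 2 ^ n" using real_arch_pow[of 2 "t / s"] by auto
  then have "t \<le> 2 ^ n * s" using st by (simp add: field_simps)
  ultimately show ?thesis by blast
qed

text \<open>
  On intervals with \<open>t > 2 * s\<close> the target \<open>s powr (\<eta> - \<alpha>) * (t - s) powr \<alpha>\<close> is at least of order
  \<open>t powr \<eta>\<close>, which is what chaining yields for \<open>\<eta> > 0\<close>.
\<close>

lemma singular_holder_chaining:
  fixes F :: "real \<Rightarrow> real"
  assumes \<eta>: "\<eta> > 0" "\<eta> \<le> \<alpha>" and \<alpha>: "\<alpha> > 0" and A: "A \<ge> 0"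
    and short: "\<And>s t. \<lbrakk>0 < s; s < t; t \<le> T; t \<le> 2 * s\<rbrakk>
        \<Longrightarrow> \<bar>F t - F s\<bar> \<le> A * (s powr (\<eta> - \<alpha>) * (t - s) powr \<alpha>)"
    and st: "0 < s" "s < t" "t \<le> T"
  shows "\<bar>F t - F s\<bar> \<le> A * dyadic_constant \<eta> * t powr \<eta>"
    and "\<bar>F t - F s\<bar> \<le> A * dyadic_constant \<eta> * 2 powr \<alpha> * (s powr (\<eta> - \<alpha>) * (t - s) powr \<alpha>)"
proof -
  have K: "dyadic_constant \<eta> \<ge> 1" using dyadic_constant(1) \<eta> by simp
  have "\<bar>F t - F s\<bar> \<le> A * dyadic_constant \<eta> * max (s powr \<eta>) (t powr \<eta>)"
  proof (rule dyadic_chaining[OF _ A _ st])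
    fix u v assume uv: "0 < u" "u < v" "v \<le> T" "v \<le> 2 * u"
    have "u powr (\<eta> - \<alpha>) * (v - u) powr \<alpha> \<le> u powr (\<eta> - \<alpha>) * u powr \<alpha>"
      using uv \<alpha> by (intro mult_left_mono powr_mono2) auto
    also have "\<dots> = u powr \<eta>" using uv by (simp add: powr_add[symmetric])
    finally show "\<bar>F v - F u\<bar> \<le> A * u powr \<eta>"
      using short[OF uv] mult_left_mono[OF _ A] by fastforce
  qed (use \<eta> in auto)
  also have "max (s powr \<eta>) (t powr \<eta>) = t powr \<eta>" using st \<eta> by (simp add: powr_mono2)
  finally show osc: "\<bar>F t - F s\<bar> \<le> A * dyadic_constant \<eta> * t powr \<eta>" .
  show "\<bar>F t - F s\<bar> \<le> A * dyadic_constant \<eta> * 2 powr \<alpha> * (s powr (\<eta> - \<alpha>) * (t - s) powr \<alpha>)"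
  proof (cases "t \<le> 2 * s")
    case True
    have "1 \<le> dyadic_constant \<eta> * 2 powr \<alpha>"
      using K \<alpha> mult_mono[of 1 "dyadic_constant \<eta>" 1 "2 powr \<alpha>"] by (simp add: ge_one_powr_ge_zero)
    moreover have "0 \<le> A * (s powr (\<eta> - \<alpha>) * (t - s) powr \<alpha>)" using A by simp
    ultimately have "A * (s powr (\<eta> - \<alpha>) * (t - s) powr \<alpha>) * 1
        \<le> A * (s powr (\<eta> - \<alpha>) * (t - s) powr \<alpha>) * (dyadic_constant \<eta> * 2 powr \<alpha>)"
      by (rule mult_left_mono)
    then show ?thesis using short[OF st True] by (simp add: mult_ac)
  next
    case False
    have "t powr \<eta> = t powr (\<eta> - \<alpha>) * t powr \<alpha>" using st by (simp add: powr_add[symmetric])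
    (* The interval is longer than its distance to 0, so that t <= 2 * (t - s). *)
    also have "\<dots> \<le> s powr (\<eta> - \<alpha>) * (2 * (t - s)) powr \<alpha>"
      using st False \<eta> \<alpha> by (intro mult_mono powr_mono2 powr_mono2') auto
    also have "\<dots> = 2 powr \<alpha> * (s powr (\<eta> - \<alpha>) * (t - s) powr \<alpha>)"
      using powr_mult[of 2 "t - s" \<alpha>] by (simp only: mult_ac)
    finally have "A * dyadic_constant \<eta> * t powr \<eta>
        \<le> A * dyadic_constant \<eta> * (2 powr \<alpha> * (s powr (\<eta> - \<alpha>) * (t - s) powr \<alpha>))"
      using A K by (intro mult_left_mono) auto
    then show ?thesis using osc by (simp add: mult_ac)
  qed
qed

lemma limit_at_zero:
  fixes F :: "real \<Rightarrow> real"
  assumes "T > 0" "\<gamma> > 0"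
    and osc: "\<And>s t. \<lbrakk>0 < s; s < t; t \<le> T\<rbrakk> \<Longrightarrow> \<bar>F t - F s\<bar> \<le> B * t powr \<gamma>"
  obtains L where "(F \<longlongrightarrow> L) (at_right 0)"
proof -
  define x where "x n = T / real (Suc n)" for n
  have x: "0 < x n" "x n \<le> T" for n using \<open>T > 0\<close> by (auto simp: x_def field_simps)
  have x0: "x \<longlonglongrightarrow> 0" unfolding x_def
    using tendsto_mult_right_zero[OF LIMSEQ_inverse_real_of_nat, of T] by (simp add: divide_inverse)
  have small: "((\<lambda>t. B * t powr \<gamma>) \<longlongrightarrow> 0) (at_right 0)"
  proof -
    have "((\<lambda>t::real. t powr \<gamma>) \<longlongrightarrow> 0 powr \<gamma>) (at_right 0)"
      using \<open>\<gamma> > 0\<close> eventually_at_right_less[of "0::real"]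
      by (intro tendsto_powr' tendsto_const tendsto_ident_at) (auto elim: eventually_mono)
    from tendsto_mult_right_zero[OF this[simplified], of B] show ?thesis .
  qed
  have xr: "filterlim x (at_right 0) sequentially"
    using x0 x by (auto simp: filterlim_at intro!: always_eventually less_imp_neq[symmetric])
  have "Cauchy (F \<circ> x)"
  proof (rule CauchyI)
    fix e :: real assume "e > 0"
    have "\<forall>\<^sub>F n in sequentially. \<bar>B * x n powr \<gamma>\<bar> < e"
      using tendstoD[OF filterlim_compose[OF small xr] \<open>e > 0\<close>] by (simp add: dist_real_def)
    then obtain N where N: "\<And>n. n \<ge> N \<Longrightarrow> \<bar>B * x n powr \<gamma>\<bar> < e"
      unfolding eventually_sequentially by blast
    have close: "\<bar>F (x m) - F (x n)\<bar> < e" if "m \<ge> N" "x n < x m" for m n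
      using osc[of "x n" "x m"] N[OF that(1)] x that by force
    have "norm ((F \<circ> x) m - (F \<circ> x) n) < e" if "m \<ge> N" "n \<ge> N" for m n
      using close[of m n] close[of n m] that \<open>e > 0\<close>
      by (cases "x m" "x n" rule: linorder_cases) (auto simp: abs_minus_commute)
    then show "\<exists>N. \<forall>m\<ge>N. \<forall>n\<ge>N. norm ((F \<circ> x) m - (F \<circ> x) n) < e" by blast
  qed
  then obtain L where L: "(\<lambda>n. F (x n)) \<longlonglongrightarrow> L"
    by (auto simp: Cauchy_convergent_iff convergent_def o_def)
  have "\<bar>F t - L\<bar> \<le> B * t powr \<gamma>" if "t \<in> {0<..<T}" for t
  proof (rule tendsto_upperbound)
    show "(\<lambda>n. \<bar>F t - F (x n)\<bar>) \<longlonglongrightarrow> \<bar>F t - L\<bar>" by (intro tendsto_intros L)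
    have "\<forall>\<^sub>F n in sequentially. x n < t" using order_tendstoD(2)[OF x0, of t] that by simp
    then show "\<forall>\<^sub>F n in sequentially. \<bar>F t - F (x n)\<bar> \<le> B * t powr \<gamma>"
      by eventually_elim (use osc x that in auto)
  qed simp
  then have "\<forall>\<^sub>F t in at_right 0. norm (F t - L) \<le> B * t powr \<gamma>"
    using eventually_at_right_real[OF \<open>T > 0\<close>] by (auto elim!: eventually_mono)
  from Lim_null_comparison[OF this small] have "(F \<longlongrightarrow> L) (at_right 0)"
    by (simp add: Lim_null[symmetric])
  then show thesis by (rule that)
qed

section \<open>Paths in singular Hoelder spaces\<close>

lemma singular_holder_norm_nonneg:
  assumes "T > 0" "Y \<in> singular_holder_space \<alpha> \<eta> T"
  shows "singular_holder_norm \<alpha> \<eta> T Y \<ge> 0"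
proof -
  have "\<bar>Y T - Y (T/2)\<bar> / ((T/2) powr (\<eta> - \<alpha>) * \<bar>T - T/2\<bar> powr \<alpha>) \<in> singular_holder_quotients \<alpha> \<eta> T Y"
    unfolding singular_holder_quotients_def mem_Collect_eq using \<open>T > 0\<close>
    by (intro exI[of _ "T/2"] exI[of _ T]) simp
  then have "\<bar>Y T - Y (T/2)\<bar> / ((T/2) powr (\<eta> - \<alpha>) * \<bar>T - T/2\<bar> powr \<alpha>) \<le> singular_holder_norm \<alpha> \<eta> T Y"
    unfolding singular_holder_norm_def using assms
    by (intro cSup_upper) (auto simp: singular_holder_space_def)
  then show ?thesis by (rule order_trans[rotated]) simp
qed

lemma singular_holder_bound:
  assumes "Y \<in> singular_holder_space \<alpha> \<eta> T" "0 < s" "s < t" "t \<le> T"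
  shows "\<bar>Y t - Y s\<bar> \<le> singular_holder_norm \<alpha> \<eta> T Y * (s powr (\<eta> - \<alpha>) * (t - s) powr \<alpha>)"
proof -
  have "\<bar>Y t - Y s\<bar> / (s powr (\<eta> - \<alpha>) * \<bar>t - s\<bar> powr \<alpha>) \<in> singular_holder_quotients \<alpha> \<eta> T Y"
    unfolding singular_holder_quotients_def using assms by blast
  then have "\<bar>Y t - Y s\<bar> / (s powr (\<eta> - \<alpha>) * \<bar>t - s\<bar> powr \<alpha>) \<le> singular_holder_norm \<alpha> \<eta> T Y"
    unfolding singular_holder_norm_def using assms
    by (intro cSup_upper) (auto simp: singular_holder_space_def)
  then show ?thesis using assms by (simp add: pos_divide_le_eq)
qed

lemma singular_holderI:
  assumes "T > 0" "\<alpha> > 0" "\<eta> \<le> \<alpha>" "A \<ge> 0"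
    and bound: "\<And>s t. \<lbrakk>0 < s; s < t; t \<le> T\<rbrakk> \<Longrightarrow> \<bar>G t - G s\<bar> \<le> A * (s powr (\<eta> - \<alpha>) * (t - s) powr \<alpha>)"
  shows "G \<in> singular_holder_space \<alpha> \<eta> T" and "singular_holder_norm \<alpha> \<eta> T G \<le> A"
proof -
  have le: "q \<le> A" if "q \<in> singular_holder_quotients \<alpha> \<eta> T G" for q
    using that bound by (auto simp: singular_holder_quotients_def pos_divide_le_eq)
  have "0 < T / 2" "T / 2 < T" using \<open>T > 0\<close> by simp_all
  then have "singular_holder_quotients \<alpha> \<eta> T G \<noteq> {}"
    unfolding singular_holder_quotients_def by blast
  then show "singular_holder_norm \<alpha> \<eta> T G \<le> A"
    unfolding singular_holder_norm_def using le by (rule cSup_least)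
  have "continuous_on {0<..T} G"
    unfolding continuous_on
  proof
    fix x assume x: "x \<in> {0<..T}"
    define D where "D = A * (x / 2) powr (\<eta> - \<alpha>)"
    have near: "\<bar>G t - G s\<bar> \<le> D * (t - s) powr \<alpha>" if "x / 2 < s" "s < t" "t \<le> T" for s t
    proof -
      have "s powr (\<eta> - \<alpha>) \<le> (x / 2) powr (\<eta> - \<alpha>)"
        using that x \<open>\<eta> \<le> \<alpha>\<close> by (intro powr_mono2') auto
      then have "A * (s powr (\<eta> - \<alpha>) * (t - s) powr \<alpha>) \<le> A * ((x / 2) powr (\<eta> - \<alpha>) * (t - s) powr \<alpha>)"
        using \<open>A \<ge> 0\<close> by (intro mult_left_mono mult_right_mono) auto
      then show ?thesis using bound[of s t] that x by (simp add: D_def mult_ac)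
    qed
    have "((\<lambda>y. \<bar>y - x\<bar> powr \<alpha>) \<longlongrightarrow> \<bar>x - x\<bar> powr \<alpha>) (at x within {0<..T})"
      using \<open>\<alpha> > 0\<close> by (intro tendsto_powr' tendsto_intros) auto
    then have "((\<lambda>y. \<bar>y - x\<bar> powr \<alpha>) \<longlongrightarrow> 0) (at x within {0<..T})" by simp
    then have lim0: "((\<lambda>y. D * \<bar>y - x\<bar> powr \<alpha>) \<longlongrightarrow> 0) (at x within {0<..T})"
      by (rule tendsto_mult_right_zero)
    have "\<forall>\<^sub>F y in at x within {0<..T}. x / 2 < y"
      using x by (intro order_tendstoD(1)[OF tendsto_ident_at]) auto
    moreover have "\<forall>\<^sub>F y in at x within {0<..T}. y \<in> {0<..T} \<and> y \<noteq> x"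
      by (auto simp: eventually_at_filter)
    ultimately have "\<forall>\<^sub>F y in at x within {0<..T}. norm (G y - G x) \<le> D * \<bar>y - x\<bar> powr \<alpha>"
    proof eventually_elim
      case (elim y)
      then show ?case using near[of x y] near[of y x] x
        by (cases x y rule: linorder_cases) (auto simp: abs_minus_commute)
    qed
    from Lim_null_comparison[OF this lim0] show "(G \<longlongrightarrow> G x) (at x within {0<..T})"
      by (simp add: Lim_null[symmetric])
  qed
  then show "G \<in> singular_holder_space \<alpha> \<eta> T"
    using le by (auto simp: singular_holder_space_def bdd_above_def)
qed

lemma powr_mono_ratio:
  fixes s :: real
  assumes "0 < s" "s \<le> T" "m \<le> \<gamma>"
  shows "s powr \<gamma> \<le> T powr (\<gamma> - m) * s powr m"
proof -
  have "s powr \<gamma> = s powr (\<gamma> - m) * s powr m" using assms by (simp add: powr_add[symmetric])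
  also have "\<dots> \<le> T powr (\<gamma> - m) * s powr m"
    using assms by (intro mult_right_mono powr_mono2) auto
  finally show ?thesis .
qed

text \<open>
  Chaining from \<open>s\<close> up to \<open>T\<close> bounds \<open>\<bar>Y T - Y s\<bar>\<close> by a multiple of the larger of \<open>s powr \<eta>\<close> and
  \<open>T powr \<eta>\<close>. The powers of \<open>T\<close> in the constant express both this maximum and \<open>\<bar>Y T\<bar>\<close> as
  multiples of \<open>s powr m\<close>.
\<close>

lemma singular_holder_growth:
  assumes "T > 0" "\<alpha> > 0" "\<eta> \<noteq> 0" and Y: "Y \<in> singular_holder_space \<alpha> \<eta> T" and s: "0 < s" "s \<le> T"
  defines "m \<equiv> min \<eta> 0"
  shows "\<bar>Y s\<bar> \<le> (T powr (- m) + dyadic_constant \<eta> * T powr (\<eta> - m))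
      * (\<bar>Y T\<bar> + singular_holder_norm \<alpha> \<eta> T Y) * s powr m"
proof -
  let ?N = "singular_holder_norm \<alpha> \<eta> T Y" and ?K = "dyadic_constant \<eta>"
  have N: "?N \<ge> 0" using singular_holder_norm_nonneg[OF \<open>T > 0\<close> Y] .
  have K: "?K \<ge> 0" using dyadic_constant(1)[OF \<open>\<eta> \<noteq> 0\<close>] by simp
  have step: "\<bar>Y v - Y u\<bar> \<le> ?N * u powr \<eta>" if "0 < u" "u < v" "v \<le> T" "v \<le> 2 * u" for u v
  proof -
    have "u powr (\<eta> - \<alpha>) * (v - u) powr \<alpha> \<le> u powr (\<eta> - \<alpha>) * u powr \<alpha>"
      using that \<open>\<alpha> > 0\<close> by (intro mult_left_mono powr_mono2) auto
    also have "\<dots> = u powr \<eta>" using that by (simp add: powr_add[symmetric])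
    finally show ?thesis using singular_holder_bound[OF Y that(1-3)] mult_left_mono[OF _ N] by fastforce
  qed
  have diff: "\<bar>Y T - Y s\<bar> \<le> ?N * ?K * (T powr (\<eta> - m) * s powr m)"
  proof (cases "s = T")
    case True
    then show ?thesis using N K by simp
  next
    case False
    have "\<bar>Y T - Y s\<bar> \<le> ?N * ?K * max (s powr \<eta>) (T powr \<eta>)"
      using dyadic_chaining[OF \<open>\<eta> \<noteq> 0\<close> N, of T Y s T] step s False by simp
    also have "max (s powr \<eta>) (T powr \<eta>) \<le> T powr (\<eta> - m) * s powr m"
    proof (cases "\<eta> > 0")
      case True
      then show ?thesis using s by (simp add: m_def powr_mono2)
    next
      case False
      then show ?thesis using s \<open>T > 0\<close> by (simp add: m_def powr_mono2')
    qed
    finally show ?thesis using N K by (simp add: mult_left_mono)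
  qed
  have "1 = T powr (- m) * T powr m" using \<open>T > 0\<close> by (simp add: powr_add[symmetric])
  also have "\<dots> \<le> T powr (- m) * s powr m"
    using s by (intro mult_left_mono powr_mono2') (auto simp: m_def)
  finally have YT: "\<bar>Y T\<bar> \<le> \<bar>Y T\<bar> * (T powr (- m) * s powr m)"
    using mult_left_mono[of 1 _ "\<bar>Y T\<bar>"] by simp
  have "\<bar>Y s\<bar> \<le> \<bar>Y T\<bar> * (T powr (- m) * s powr m) + ?N * ?K * (T powr (\<eta> - m) * s powr m)"
    using diff YT by arith
  also have "\<dots> \<le> (\<bar>Y T\<bar> + ?N) * (T powr (- m) * s powr m) + (\<bar>Y T\<bar> + ?N) * (?K * (T powr (\<eta> - m) * s powr m))"
    unfolding mult.assoc using N K by (intro add_mono mult_right_mono) auto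
  also have "\<dots> = (T powr (- m) + ?K * T powr (\<eta> - m)) * (\<bar>Y T\<bar> + ?N) * s powr m"
    by (simp add: algebra_simps)
  finally show ?thesis .
qed

section \<open>Young integrals on singular Hoelder spaces\<close>

text \<open>
  The Riemann sum and the telescoping sum of the increments of \<open>F\<close> differ by at most the sum of
  \<open>H * (v - u) powr \<theta>\<close> over the partition intervals, hence by at most
  \<open>H * d powr (\<theta> - 1) * (t - s)\<close> if the mesh is at most \<open>d\<close>.
\<close>

lemma has_young_integral_of_primitive:
  assumes "s < t" "\<theta> > 1" "H \<ge> 0"
    and local_error: "\<And>u v. \<lbrakk>s \<le> u; u < v; v \<le> t\<rbrakk> \<Longrightarrow> \<bar>F v - F u - Y u * (X v - X u)\<bar> \<le> H * (v - u) powr \<theta>"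
  shows "has_young_integral Y X s t (F t - F s)"
  unfolding has_young_integral_def
proof (intro allI impI)
  fix e :: real assume "e > 0"
  (* The summand 1 keeps Q positive when H = 0. *)
  define Q where "Q = H * (t - s) + 1"
  have Q: "Q > 0" "H * (t - s) < Q" using \<open>H \<ge> 0\<close> \<open>s < t\<close> by (auto simp: Q_def add_nonneg_pos)
  define d where "d = (e / Q) powr (1 / (\<theta> - 1))"
  have "d > 0" using \<open>e > 0\<close> Q by (simp add: d_def)
  have dQ: "d powr (\<theta> - 1) = e / Q"
    using \<open>e > 0\<close> Q \<open>\<theta> > 1\<close> by (simp add: d_def powr_powr)
  have "\<bar>left_riemann_sum Y X n p - (F t - F s)\<bar> < e"
    if p: "partition_points s t n p" and mesh: "\<And>i. i < n \<Longrightarrow> p (Suc i) - p i < d" for n p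
  proof -
    have p0: "p 0 = s" "p n = t" and inc: "\<And>i. i < n \<Longrightarrow> p i < p (Suc i)"
      using p by (auto simp: partition_points_def)
    have mono: "p i \<le> p j" if "i \<le> j" "j \<le> n" for i j
      using that
    proof (induction rule: dec_induct)
      case (step k)
      then show ?case using inc[of k] by simp
    qed simp
    have range: "s \<le> p i" "p i \<le> t" if "i \<le> n" for i
      using mono[of 0 i] mono[of i n] that p0 by auto
    have tele: "(\<Sum>i<n. G (p (Suc i)) - G (p i)) = G t - G s" for G :: "real \<Rightarrow> real"
      using sum_lessThan_telescope[of "\<lambda>i. G (p i)" n] p0 by simp
    have "\<bar>left_riemann_sum Y X n p - (F t - F s)\<bar>
        = \<bar>\<Sum>i<n. Y (p i) * (X (p (Suc i)) - X (p i)) - (F (p (Suc i)) - F (p i))\<bar>"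
      unfolding left_riemann_sum_def tele[of F, symmetric] by (simp only: sum_subtractf)
    also have "\<dots> \<le> (\<Sum>i<n. H * (e / Q) * (p (Suc i) - p i))"
    proof (rule order_trans[OF sum_abs], rule sum_mono)
      fix i assume "i \<in> {..<n}"
      then have i: "i < n" by simp
      let ?u = "p i" and ?v = "p (Suc i)"
      have "\<bar>Y ?u * (X ?v - X ?u) - (F ?v - F ?u)\<bar> \<le> H * (?v - ?u) powr \<theta>"
        using local_error[of ?u ?v] range[of i] range[of "Suc i"] inc[OF i] i
        by (simp add: abs_minus_commute)
      also have "(?v - ?u) powr \<theta> = (?v - ?u) powr (\<theta> - 1) * (?v - ?u)"
        using inc[OF i] by (simp add: powr_diff)
      also have "\<dots> \<le> d powr (\<theta> - 1) * (?v - ?u)"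
        using inc[OF i] mesh[OF i] \<open>\<theta> > 1\<close> by (intro mult_right_mono powr_mono2) auto
      finally show "\<bar>Y ?u * (X ?v - X ?u) - (F ?v - F ?u)\<bar> \<le> H * (e / Q) * (?v - ?u)"
        using \<open>H \<ge> 0\<close> by (simp add: dQ mult_left_mono mult.assoc)
    qed
    also have "\<dots> = H * (e / Q) * (t - s)"
      unfolding sum_distrib_left[symmetric] using tele[of "\<lambda>x. x"] by simp
    also have "\<dots> = e / Q * (H * (t - s))" by (simp add: mult_ac)
    also have "\<dots> < e / Q * Q" using Q \<open>e > 0\<close> by (intro mult_strict_left_mono) auto
    also have "\<dots> = e" using Q by simp
    finally show ?thesis .
  qed
  then show "\<exists>d>0. \<forall>n p. partition_points s t n p \<and> (\<forall>i<n. p (Suc i) - p i < d)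
      \<longrightarrow> \<bar>left_riemann_sum Y X n p - (F t - F s)\<bar> < e"
    using \<open>d > 0\<close> by blast
qed

text \<open>
  Both singular weights are decreasing, so each may be evaluated at the left end point of the whole
  interval; this gives the antitone weight that sewing asks for.
\<close>

lemma singular_young_primitive:
  assumes "T > 0" "0 < \<alpha>1" "0 < \<alpha>2" "\<alpha>1 + \<alpha>2 > 1" "\<eta>1 \<le> \<alpha>1" "\<eta>2 \<le> \<alpha>2"
    and Y: "Y \<in> singular_holder_space \<alpha>1 \<eta>1 T" and X: "X \<in> singular_holder_space \<alpha>2 \<eta>2 T"
  obtains F where "\<And>u v. \<lbrakk>0 < u; u < v; v \<le> T\<rbrakk> \<Longrightarrow> \<bar>F v - F u - Y u * (X v - X u)\<bar>
      \<le> sewing_constant (\<alpha>1 + \<alpha>2) * (singular_holder_norm \<alpha>1 \<eta>1 T Y * singular_holder_norm \<alpha>2 \<eta>2 T X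
          * u powr (\<eta>1 + \<eta>2 - (\<alpha>1 + \<alpha>2)) * (v - u) powr (\<alpha>1 + \<alpha>2))"
proof -
  let ?N = "singular_holder_norm \<alpha>1 \<eta>1 T Y" and ?M = "singular_holder_norm \<alpha>2 \<eta>2 T X"
  let ?w = "\<lambda>u. ?N * ?M * u powr (\<eta>1 + \<eta>2 - (\<alpha>1 + \<alpha>2))"
  have N: "?N \<ge> 0" and M: "?M \<ge> 0"
    using singular_holder_norm_nonneg[OF \<open>T > 0\<close>] Y X by auto
  have defect: "\<bar>Y a * (X c - X a) - Y a * (X b - X a) - Y b * (X c - X b)\<bar>
      \<le> ?w a * (c - a) powr (\<alpha>1 + \<alpha>2)"
    if abc: "0 < a" "a \<le> b" "b \<le> c" "c \<le> T" for a b c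
  proof (cases "a = b \<or> b = c")
    case True
    then show ?thesis using N M by auto
  next
    case False
    then have less: "a < b" "b < c" using abc by auto
    have "\<bar>Y b - Y a\<bar> \<le> ?N * (a powr (\<eta>1 - \<alpha>1) * (b - a) powr \<alpha>1)"
      using singular_holder_bound[OF Y] abc less by simp
    also have "\<dots> \<le> ?N * (a powr (\<eta>1 - \<alpha>1) * (c - a) powr \<alpha>1)"
      using abc less assms N by (intro mult_left_mono powr_mono2) auto
    finally have 1: "\<bar>Y b - Y a\<bar> \<le> ?N * (a powr (\<eta>1 - \<alpha>1) * (c - a) powr \<alpha>1)" .
    have "\<bar>X c - X b\<bar> \<le> ?M * (b powr (\<eta>2 - \<alpha>2) * (c - b) powr \<alpha>2)"
      using singular_holder_bound[OF X] abc less by simp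
    also have "\<dots> \<le> ?M * (a powr (\<eta>2 - \<alpha>2) * (c - a) powr \<alpha>2)"
      using abc less assms M by (intro mult_left_mono mult_mono powr_mono2 powr_mono2') auto
    finally have 2: "\<bar>X c - X b\<bar> \<le> ?M * (a powr (\<eta>2 - \<alpha>2) * (c - a) powr \<alpha>2)" .
    have "Y a * (X c - X a) - Y a * (X b - X a) - Y b * (X c - X b) = - ((Y b - Y a) * (X c - X b))"
      by (simp add: algebra_simps)
    then have "\<bar>Y a * (X c - X a) - Y a * (X b - X a) - Y b * (X c - X b)\<bar> = \<bar>Y b - Y a\<bar> * \<bar>X c - X b\<bar>"
      by (simp add: abs_mult)
    also have "\<dots> \<le> (?N * (a powr (\<eta>1 - \<alpha>1) * (c - a) powr \<alpha>1)) * (?M * (a powr (\<eta>2 - \<alpha>2) * (c - a) powr \<alpha>2))"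
      using 1 2 N by (intro mult_mono) auto
    also have "\<dots> = ?N * ?M * (a powr (\<eta>1 - \<alpha>1) * a powr (\<eta>2 - \<alpha>2)) * ((c - a) powr \<alpha>1 * (c - a) powr \<alpha>2)"
      by (simp add: mult_ac)
    also have "\<dots> = ?w a * (c - a) powr (\<alpha>1 + \<alpha>2)"
      by (simp add: powr_add[symmetric] algebra_simps)
    finally show ?thesis .
  qed
  note obtained = that
  show thesis
  proof (rule sewing[of "\<alpha>1 + \<alpha>2" T "{0<..T}" ?w "\<lambda>u v. Y u * (X v - X u)"])
    show "?w y \<le> ?w x" if "x \<in> {0<..T}" "y \<in> {0<..T}" "x \<le> y" for x y
      using that N M assms by (intro mult_left_mono powr_mono2') auto
    show thesis if "\<And>u v. \<lbrakk>u \<in> {0<..T}; v \<in> {0<..T}; u < v\<rbrakk> \<Longrightarrow> \<bar>F v - F u - Y u * (X v - X u)\<bar>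
      \<le> sewing_constant (\<alpha>1 + \<alpha>2) * (?w u * (v - u) powr (\<alpha>1 + \<alpha>2))" for F
      using that by (intro obtained) auto
  qed (use assms N M defect in auto)
qed

theorem theorem2p5:
  fixes T \<alpha>1 \<alpha>2 \<eta>1 \<eta>2 :: real
  assumes "T > 0"
    and "0 < \<alpha>1" and "\<alpha>1 < 1" and "0 < \<alpha>2" and "\<alpha>2 < 1" and "\<alpha>1 + \<alpha>2 > 1"
    and "\<eta>1 \<le> \<alpha>1" and "\<eta>2 \<le> \<alpha>2"
    and "\<eta>2 > 0" and "\<eta>1 + \<eta>2 > 0" and "\<eta>1 \<noteq> 0"
  shows "min \<eta>1 0 + \<eta>2 > 0 \<and>
    (\<forall>Y \<in> singular_holder_space \<alpha>1 \<eta>1 T. \<forall>X \<in> singular_holder_space \<alpha>2 \<eta>2 T.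
       (\<forall>t\<in>{0<..T}. \<exists>I. has_improper_young_integral Y X t I) \<and>
       improper_young_integral Y X \<in> singular_holder_space \<alpha>2 (min \<eta>1 0 + \<eta>2) T) \<and>
    (\<exists>M>0. \<forall>Y \<in> singular_holder_space \<alpha>1 \<eta>1 T. \<forall>X \<in> singular_holder_space \<alpha>2 \<eta>2 T.
       singular_holder_norm \<alpha>2 (min \<eta>1 0 + \<eta>2) T (improper_young_integral Y X)
         \<le> M * (\<bar>Y T\<bar> + singular_holder_norm \<alpha>1 \<eta>1 T Y) * singular_holder_norm \<alpha>2 \<eta>2 T X)"
proof -
  define m where "m = min \<eta>1 0"
  define \<eta> where "\<eta> = m + \<eta>2"
  define \<theta> where "\<theta> = \<alpha>1 + \<alpha>2"
  have \<eta>: "\<eta> > 0" "\<eta> \<le> \<alpha>2" using assms by (auto simp: \<eta>_def m_def)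
  (* The first two summands bound the germ through the growth of Y, the third one bounds the sewing error. *)
  define c where "c = T powr (- m) + dyadic_constant \<eta>1 * T powr (\<eta>1 - m)
      + sewing_constant \<theta> * T powr (\<eta>1 - m)"
  have Kpos: "dyadic_constant \<eta>1 \<ge> 1" "dyadic_constant \<eta> \<ge> 1" "sewing_constant \<theta> > 0"
    using dyadic_constant(1)[of \<eta>1] dyadic_constant(1)[of \<eta>] sewing_constant_pos[of \<theta>] \<eta> assms
    by (auto simp: \<theta>_def)
  then have "c > 0" unfolding c_def using assms(1) by (intro add_pos_pos) auto
  define M where "M = c * dyadic_constant \<eta> * 2 powr \<alpha>2"
  have "M > 0" using \<open>c > 0\<close> Kpos by (simp add: M_def)
  have main: "(\<forall>t\<in>{0<..T}. \<exists>I. has_improper_young_integral Y X t I) \<and>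
      improper_young_integral Y X \<in> singular_holder_space \<alpha>2 \<eta> T \<and>
      singular_holder_norm \<alpha>2 \<eta> T (improper_young_integral Y X)
         \<le> M * (\<bar>Y T\<bar> + singular_holder_norm \<alpha>1 \<eta>1 T Y) * singular_holder_norm \<alpha>2 \<eta>2 T X"
    if Y: "Y \<in> singular_holder_space \<alpha>1 \<eta>1 T" and X: "X \<in> singular_holder_space \<alpha>2 \<eta>2 T" for Y X
  proof -
    define N1 where "N1 = singular_holder_norm \<alpha>1 \<eta>1 T Y"
    define N2 where "N2 = singular_holder_norm \<alpha>2 \<eta>2 T X"
    have N: "N1 \<ge> 0" "N2 \<ge> 0"
      using singular_holder_norm_nonneg[OF assms(1)] Y X by (auto simp: N1_def N2_def)
    define A where "A = c * (\<bar>Y T\<bar> + N1) * N2"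
    have "A \<ge> 0" using \<open>c > 0\<close> N by (simp add: A_def)
    obtain F where F: "\<And>u v. \<lbrakk>0 < u; u < v; v \<le> T\<rbrakk> \<Longrightarrow> \<bar>F v - F u - Y u * (X v - X u)\<bar>
        \<le> sewing_constant \<theta> * (N1 * N2 * u powr (\<eta>1 + \<eta>2 - \<theta>) * (v - u) powr \<theta>)"
      using singular_young_primitive[OF assms(1,2,4,6,7,8) Y X] unfolding N1_def N2_def \<theta>_def by metis
    have young: "has_young_integral Y X s t (F t - F s)" if st: "0 < s" "s < t" "t \<le> T" for s t
    proof (rule has_young_integral_of_primitive[OF st(2)])
      show "\<theta> > 1" using assms by (simp add: \<theta>_def)
      show "0 \<le> sewing_constant \<theta> * (N1 * N2 * s powr (\<eta>1 + \<eta>2 - \<theta>))" using Kpos N by simp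
      fix u v assume uv: "s \<le> u" "u < v" "v \<le> t"
      have "u powr (\<eta>1 + \<eta>2 - \<theta>) \<le> s powr (\<eta>1 + \<eta>2 - \<theta>)"
        using uv st assms by (intro powr_mono2') (auto simp: \<theta>_def)
      then have "sewing_constant \<theta> * (N1 * N2 * u powr (\<eta>1 + \<eta>2 - \<theta>) * (v - u) powr \<theta>)
          \<le> sewing_constant \<theta> * (N1 * N2 * s powr (\<eta>1 + \<eta>2 - \<theta>) * (v - u) powr \<theta>)"
        using Kpos N by (intro mult_left_mono mult_right_mono) auto
      then show "\<bar>F v - F u - Y u * (X v - X u)\<bar>
          \<le> sewing_constant \<theta> * (N1 * N2 * s powr (\<eta>1 + \<eta>2 - \<theta>)) * (v - u) powr \<theta>"
        using F[of u v] uv st by (simp add: mult.assoc)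
    qed
    have short: "\<bar>F t - F s\<bar> \<le> A * (s powr (\<eta> - \<alpha>2) * (t - s) powr \<alpha>2)"
      if st: "0 < s" "s < t" "t \<le> T" "t \<le> 2 * s" for s t
    proof -
      let ?g = "s powr (\<eta> - \<alpha>2) * (t - s) powr \<alpha>2" and ?B = "\<bar>Y T\<bar> + N1"
      let ?c1 = "T powr (- m) + dyadic_constant \<eta>1 * T powr (\<eta>1 - m)"
      have powers: "s powr m * s powr (\<eta>2 - \<alpha>2) = s powr (\<eta> - \<alpha>2)"
        by (simp add: powr_add[symmetric] \<eta>_def algebra_simps)
      have "\<bar>Y s * (X t - X s)\<bar> \<le> (?c1 * ?B * s powr m) * (N2 * (s powr (\<eta>2 - \<alpha>2) * (t - s) powr \<alpha>2))"
        unfolding abs_mult N1_def N2_def m_def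
        using singular_holder_growth[OF assms(1,2,11) Y, of s] singular_holder_bound[OF X st(1-3)] st
          Kpos N by (intro mult_mono) (auto simp: N1_def m_def)
      also have "\<dots> = ?c1 * ?B * N2 * (s powr m * s powr (\<eta>2 - \<alpha>2) * (t - s) powr \<alpha>2)"
        by (simp only: mult_ac)
      also note powers
      finally have germ: "\<bar>Y s * (X t - X s)\<bar> \<le> ?c1 * ?B * N2 * ?g" .
      have "s powr (\<eta>1 + \<eta>2 - \<theta>) * (t - s) powr \<theta> = s powr (\<eta>1 + \<eta>2 - \<theta>) * (t - s) powr \<alpha>1 * (t - s) powr \<alpha>2"
        by (simp add: \<theta>_def powr_add)
      also have "\<dots> \<le> s powr (\<eta>1 + \<eta>2 - \<theta>) * s powr \<alpha>1 * (t - s) powr \<alpha>2"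
        using st assms by (intro mult_left_mono mult_right_mono powr_mono2) auto
      also have "\<dots> = s powr \<eta>1 * (s powr (\<eta>2 - \<alpha>2) * (t - s) powr \<alpha>2)"
        by (simp add: powr_add[symmetric] mult.assoc[symmetric] \<theta>_def)
      also have "\<dots> \<le> (T powr (\<eta>1 - m) * s powr m) * (s powr (\<eta>2 - \<alpha>2) * (t - s) powr \<alpha>2)"
        using st by (intro mult_right_mono powr_mono_ratio) (auto simp: m_def)
      also have "\<dots> = T powr (\<eta>1 - m) * ?g"
        by (simp add: powers[symmetric] mult.assoc)
      finally have "sewing_constant \<theta> * (N1 * N2 * (s powr (\<eta>1 + \<eta>2 - \<theta>) * (t - s) powr \<theta>))
          \<le> sewing_constant \<theta> * (N1 * N2 * (T powr (\<eta>1 - m) * ?g))"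
        using Kpos N by (intro mult_left_mono) auto
      also have "\<dots> \<le> sewing_constant \<theta> * (?B * N2 * (T powr (\<eta>1 - m) * ?g))"
        using Kpos N by (intro mult_left_mono mult_right_mono) auto
      finally have "\<bar>F t - F s - Y s * (X t - X s)\<bar> \<le> sewing_constant \<theta> * (?B * N2 * (T powr (\<eta>1 - m) * ?g))"
        using F[OF st(1-3)] by (simp add: mult.assoc)
      with germ have "\<bar>F t - F s\<bar> \<le> ?c1 * ?B * N2 * ?g + sewing_constant \<theta> * (?B * N2 * (T powr (\<eta>1 - m) * ?g))"
        by arith
      also have "\<dots> = A * ?g" by (simp add: A_def c_def algebra_simps)
      finally show ?thesis .
    qed
    have osc: "\<bar>F t - F s\<bar> \<le> A * dyadic_constant \<eta> * t powr \<eta>" if "0 < s" "s < t" "t \<le> T" for s t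
      by (rule singular_holder_chaining(1)[OF \<eta> assms(4) \<open>A \<ge> 0\<close> short that])
    have holder: "\<bar>F t - F s\<bar> \<le> A * dyadic_constant \<eta> * 2 powr \<alpha>2 * (s powr (\<eta> - \<alpha>2) * (t - s) powr \<alpha>2)"
      if "0 < s" "s < t" "t \<le> T" for s t
      by (rule singular_holder_chaining(2)[OF \<eta> assms(4) \<open>A \<ge> 0\<close> short that])
    obtain L where L: "(F \<longlongrightarrow> L) (at_right 0)"
      using limit_at_zero[OF assms(1) \<eta>(1) osc] by blast
    have lim: "((\<lambda>\<epsilon>. young_integral Y X \<epsilon> t) \<longlongrightarrow> F t - L) (at_right 0)" if t: "t \<in> {0<..T}" for t
    proof (rule tendsto_cong[THEN iffD2])
      show "\<forall>\<^sub>F \<epsilon> in at_right 0. young_integral Y X \<epsilon> t = F t - F \<epsilon>"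
        using eventually_at_right_real[of 0 t] t
        by (auto elim!: eventually_mono intro!: young_integral_eq young)
    qed (intro tendsto_intros L)
    have ex: "has_improper_young_integral Y X t (F t - L)" if "t \<in> {0<..T}" for t
      unfolding has_improper_young_integral_def young_integrable_def
      using lim[OF that] young that by fastforce
    have imp: "improper_young_integral Y X t = F t - L" if "t \<in> {0<..T}" for t
      unfolding improper_young_integral_def using lim[OF that] by (intro tendsto_Lim) auto
    have bound: "\<bar>improper_young_integral Y X t - improper_young_integral Y X s\<bar>
        \<le> M * (\<bar>Y T\<bar> + N1) * N2 * (s powr (\<eta> - \<alpha>2) * (t - s) powr \<alpha>2)"
      if "0 < s" "s < t" "t \<le> T" for s t
      using holder[OF that] that by (simp add: imp M_def A_def mult_ac)
    have "0 \<le> M * (\<bar>Y T\<bar> + N1) * N2" using \<open>M > 0\<close> N by simp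
    note singular_holderI[OF assms(1,4) \<eta>(2) this bound]
    then show ?thesis using ex unfolding N1_def N2_def by blast
  qed
  then show ?thesis using \<eta>(1) \<open>M > 0\<close> unfolding \<eta>_def m_def by blast
qed

end
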